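(* Let $T\ge 1$ be an integer, let $N\ge 5$ be a prime number, and suppose that $\Omega$ is the (random) set of values taken by $n$ independent random variables $X_1,\ldots,X_n$ uniformly distributed on $\mathbb{Z}_N=\mathbb{Z}/N\mathbb{Z}$. Assume that $$n=4CT^2\log N\qquad (C>1).$$ Then the function $L$ defined by $$L(t)=\sum_{j=1}^n e^{2\pi i tX_j/N}\qquad (t\in\mathbb{Z}_N)$$ satisfies $$P\Big(\sup_{t\in\mathbb{Z}_N\setminus\{0\}}|L(t)|<\frac{1}{2T}L(0)\Big)>1-\frac{\nu}{2}N^{1-Ca^2}$$ for all integers $\nu\ge 3$ and $a^2=\cos^2\frac{\pi}{\nu}$. Consequently $$P\Big(\text{for all signals } x \text{ with } \|x\|_0\le T,\ \text{property } (\alpha) \text{ holds for } x \text{ and } \Omega\Big)=1-O(N^{-\delta})\qquad (N\to\infty)$$ for all $\delta<C-1$.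
   Context: Let $G=\mathbb{Z}_N=\mathbb{Z}/N\mathbb{Z}$ (the space of times $t$) and let $\hat G$ be its dual group, also represented by $\mathbb{Z}_N$ (the space of frequencies $\omega$). The variables $X_j$ are random frequencies, not necessarily distinct, so $\Omega\subset\hat G$ and $|\Omega|\le n$. A signal is a function $x:G\to\mathbb{C}$. Its Fourier transform is $$\hat x(\omega)=\frac{1}{\sqrt N}\sum_{t\in G}x(t)e^{-2\pi i t\omega/N}\qquad(\omega\in\hat G).$$ $\|x\|_0$ denotes the cardinality of the support of $x$, and $\|x\|_1=\sum_{t\in G}|x(t)|$. The space $A(\hat G)$ is the set of Fourier transforms $\hat x$ of signals, with norm $\|\hat x\|_A=\|x\|_1$. Property $(\alpha)$, for a signal $x$ and a set $\Omega\subset\hat G$: $\hat x$ is the (unique) extension of $\hat x|_\Omega$ to $\hat G$ of minimal norm in $A(\hat G)$; equivalently, every signal $y\neq x$ with $\hat y(\omega)=\hat x(\omega)$ for all $\omega\in\Omega$ satisfies $\|y\|_1>\|x\|_1$. $P(\cdot)$ denotes the probability of an event and $\log$ is the natural logarithm. *)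

theory Defs
  imports "HOL-Probability.Probability" "HOL-Library.Landau_Symbols"
begin

text \<open>Both the group \<open>\<int>/N\<int>\<close> and its dual are represented by the residues \<open>{..<N}\<close>. Functions on
  them are extensional, so that equality of functions means agreement on \<open>{..<N}\<close>.\<close>

definition signals :: "nat \<Rightarrow> (nat \<Rightarrow> complex) set" where
  "signals N = {..<N} \<rightarrow>\<^sub>E UNIV"

definition fourier :: "nat \<Rightarrow> (nat \<Rightarrow> complex) \<Rightarrow> nat \<Rightarrow> complex" where
  "fourier N x = (\<lambda>\<omega>\<in>{..<N}.
     1 / complex_of_real (sqrt (real N)) *
     (\<Sum>t<N. x t * exp (- 2 * complex_of_real pi * \<i> * of_nat t * of_nat \<omega> / of_nat N)))"

definition l0_norm :: "nat \<Rightarrow> (nat \<Rightarrow> complex) \<Rightarrow> nat" where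
  "l0_norm N x = card {t \<in> {..<N}. x t \<noteq> 0}"

definition l1_norm :: "nat \<Rightarrow> (nat \<Rightarrow> complex) \<Rightarrow> real" where
  "l1_norm N x = (\<Sum>t<N. cmod (x t))"

definition A_space :: "nat \<Rightarrow> (nat \<Rightarrow> complex) set" where
  "A_space N = fourier N ` signals N"

text \<open>The inverse below is meaningful because \<open>fourier N\<close> is injective on \<open>signals N\<close>
  (\<open>inj_on_fourier\<close>); \<open>A_norm_fourier\<close> is the characteristic equation.\<close>

definition A_norm :: "nat \<Rightarrow> (nat \<Rightarrow> complex) \<Rightarrow> real" where
  "A_norm N f = l1_norm N (the_inv_into (signals N) (fourier N) f)"

definition property_alpha :: "nat \<Rightarrow> nat set \<Rightarrow> (nat \<Rightarrow> complex) \<Rightarrow> bool" where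
  "property_alpha N \<Omega> x \<longleftrightarrow>
     (\<forall>f\<in>A_space N. (\<forall>\<omega>\<in>\<Omega>. f \<omega> = fourier N x \<omega>) \<longrightarrow> f \<noteq> fourier N x \<longrightarrow>
        A_norm N (fourier N x) < A_norm N f)"

definition exp_sum :: "nat \<Rightarrow> nat \<Rightarrow> (nat \<Rightarrow> nat) \<Rightarrow> nat \<Rightarrow> complex" where
  "exp_sum N n X t =
     (\<Sum>j = 1..n. exp (2 * complex_of_real pi * \<i> * of_nat t * of_nat (X j) / of_nat N))"

locale uniform_sample = prob_space M for M :: "'w measure" +
  fixes N n :: nat and X :: "nat \<Rightarrow> 'w \<Rightarrow> nat"
  assumes indep: "indep_vars (\<lambda>_. count_space {..<N}) X {1..n}"
    and uniform: "\<And>j. j \<in> {1..n} \<Longrightarrow>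
      distr M (count_space {..<N}) (X j) = uniform_count_measure {..<N}"

text \<open>Since \<open>exp_sum N n X 0 = of_nat n\<close>, taking the real part below loses nothing.\<close>

definition small_sum_prob ::
    "'w measure \<Rightarrow> nat \<Rightarrow> nat \<Rightarrow> nat \<Rightarrow> (nat \<Rightarrow> 'w \<Rightarrow> nat) \<Rightarrow> real" where
  "small_sum_prob M T N n X = measure M {w \<in> space M.
     (SUP t\<in>{..<N} - {0}. cmod (exp_sum N n (\<lambda>j. X j w) t))
       < 1 / (2 * real T) * Re (exp_sum N n (\<lambda>j. X j w) 0)}"

definition recovery_prob ::
    "'w measure \<Rightarrow> nat \<Rightarrow> nat \<Rightarrow> nat \<Rightarrow> (nat \<Rightarrow> 'w \<Rightarrow> nat) \<Rightarrow> real" where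
  "recovery_prob M T N n X = measure M {w \<in> space M.
     \<forall>x\<in>signals N. l0_norm N x \<le> T \<longrightarrow> property_alpha N ((\<lambda>j. X j w) ` {1..n}) x}"

lemma character_sum:
  fixes s t N :: nat
  assumes "s < N" "t < N"
  shows "(\<Sum>\<omega><N. exp (- 2 * complex_of_real pi * \<i> * of_nat t * of_nat \<omega> / of_nat N)
      * exp (2 * complex_of_real pi * \<i> * of_nat s * of_nat \<omega> / of_nat N))
    = (if s = t then of_nat N else 0)"
proof -
  define q where
    "q = exp (2 * complex_of_real pi * \<i> * (of_nat s - of_nat t) / of_nat N)"
  have N: "N > 0" using assms by simp
  have "exp (- 2 * complex_of_real pi * \<i> * of_nat t * of_nat \<omega> / of_nat N)
      * exp (2 * complex_of_real pi * \<i> * of_nat s * of_nat \<omega> / of_nat N) = q ^ \<omega>" for \<omega>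
    using N unfolding q_def exp_of_nat_mult[symmetric] exp_add[symmetric]
    by (intro arg_cong[of _ _ exp]) (simp add: field_simps)
  then have eq: "(\<Sum>\<omega><N. exp (- 2 * complex_of_real pi * \<i> * of_nat t * of_nat \<omega> / of_nat N)
      * exp (2 * complex_of_real pi * \<i> * of_nat s * of_nat \<omega> / of_nat N)) = (\<Sum>\<omega><N. q ^ \<omega>)"
    by simp
  show ?thesis
  proof (cases "s = t")
    case True
    then show ?thesis unfolding eq by (simp add: q_def)
  next
    case False
    have "q \<noteq> 1"
    proof
      assume "q = 1"
      then obtain k :: int where
        "2 * pi * (real s - real t) / real N = of_int (2 * k) * pi"
        unfolding q_def exp_eq_1 by auto
      then have "pi * (real s - real t) = pi * (of_int k * real N)"
        using N by (simp add: field_simps)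
      then have "real s - real t = of_int k * real N"
        by simp
      then have "of_int (int s - int t) = (of_int (k * int N) :: real)" by simp
      then have k: "int s - int t = k * int N" by (simp only: of_int_eq_iff)
      then have "int N dvd int s - int t" by simp
      moreover have "\<bar>int s - int t\<bar> < int N" using assms by auto
      ultimately have "int s - int t = 0" using zdvd_not_zless[of "\<bar>int s - int t\<bar>" "int N"] by auto
      with False show False by simp
    qed
    moreover have "q ^ N = 1"
    proof -
      have "q ^ N = exp (2 * of_int (int s - int t) * of_real pi * \<i>)"
        using N unfolding q_def exp_of_nat_mult[symmetric]
        by (intro arg_cong[of _ _ exp]) (simp add: field_simps)
      also have "\<dots> = 1" unfolding exp_eq_1 by (auto intro!: exI[of _ "int s - int t"])
      finally show ?thesis .
    qed
    ultimately show ?thesis unfolding eq using False by (simp add: geometric_sum)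
  qed
qed

lemma fourier_inversion:
  assumes "s < N"
  shows "x s = 1 / complex_of_real (sqrt (real N)) * (\<Sum>\<omega><N. fourier N x \<omega> *
    exp (2 * complex_of_real pi * \<i> * of_nat s * of_nat \<omega> / of_nat N))"
proof -
  define c where "c = 1 / complex_of_real (sqrt (real N))"
  have cc: "c * c * of_nat N = 1"
    using assms unfolding c_def
    by (simp add: field_simps flip: of_real_mult)
  have "c * (\<Sum>\<omega><N. fourier N x \<omega> *
      exp (2 * complex_of_real pi * \<i> * of_nat s * of_nat \<omega> / of_nat N))
    = c * (\<Sum>\<omega><N. \<Sum>t<N. c * x t *
        (exp (- 2 * complex_of_real pi * \<i> * of_nat t * of_nat \<omega> / of_nat N)
         * exp (2 * complex_of_real pi * \<i> * of_nat s * of_nat \<omega> / of_nat N)))"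
    by (simp add: fourier_def c_def[symmetric] sum_distrib_left sum_distrib_right mult_ac)
  also have "\<dots> = c * (\<Sum>t<N. c * x t * (\<Sum>\<omega><N.
        exp (- 2 * complex_of_real pi * \<i> * of_nat t * of_nat \<omega> / of_nat N)
         * exp (2 * complex_of_real pi * \<i> * of_nat s * of_nat \<omega> / of_nat N)))"
    by (subst sum.swap) (simp only: sum_distrib_left)
  also have "\<dots> = c * (\<Sum>t<N. c * x t * (if s = t then of_nat N else 0))"
    using assms by (intro arg_cong[of _ _ "(*) c"] sum.cong refl) (simp only: character_sum lessThan_iff)
  also have "\<dots> = c * c * of_nat N * x s"
    using assms by (simp add: if_distrib[of "\<lambda>z. _ * z"] sum.delta' cong: if_cong)
  finally show ?thesis using cc by (simp add: c_def)
qed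

lemma inj_on_fourier: "inj_on (fourier N) (signals N)"
proof (rule inj_onI)
  fix x y assume "x \<in> signals N" "y \<in> signals N" and eq: "fourier N x = fourier N y"
  moreover have "x s = y s" if "s < N" for s
    using fourier_inversion[OF that, of x] fourier_inversion[OF that, of y] eq by simp
  ultimately show "x = y"
    unfolding signals_def by (intro PiE_ext) auto
qed

lemma A_norm_fourier: "x \<in> signals N \<Longrightarrow> A_norm N (fourier N x) = l1_norm N x"
  by (simp add: A_norm_def the_inv_into_f_f[OF inj_on_fourier])

lemma property_alpha_iff:
  assumes "x \<in> signals N"
  shows "property_alpha N \<Omega> x \<longleftrightarrow>
    (\<forall>y\<in>signals N. y \<noteq> x \<longrightarrow> (\<forall>\<omega>\<in>\<Omega>. fourier N y \<omega> = fourier N x \<omega>) \<longrightarrow>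
      l1_norm N x < l1_norm N y)"
  using assms unfolding property_alpha_def A_space_def
  by (auto simp: A_norm_fourier inj_on_eq_iff[OF inj_on_fourier])

end

theory Submission
  imports Defs
begin

text \<open>The modulus of \<open>L(t)\<close> exceeds \<open>r\<close> only if its component in one of the \<open>\<nu>\<close> directions
  \<open>2\<pi>k/\<nu>\<close> is at least \<open>ra\<close>. Such a component is a sum of independent variables
  \<open>cos (2\<pi>tX\<^sub>j/N - \<theta>)\<close>; since \<open>N\<close> is a prime \<open>\<ge> 5\<close>, their first four moments are
  those of the cosine of a uniform angle, which makes them subgaussian,
  \<open>E exp (l cos) \<le> exp (l\<^sup>2/4)\<close>, in the range \<open>0 \<le> l \<le> 1\<close>. Chernoff's bound at
  \<open>l = a/T\<close> and a union over the \<open>\<nu>\<close> directions and the \<open>(N-1)/2\<close> pairs \<open>\<plusminus>t\<close> give the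
  first estimate.

  For the second, let \<open>h\<close> be a signal whose Fourier transform vanishes on \<open>\<Omega>\<close>. Then
  \<open>L * h = 0\<close>, that is, \<open>n h(s) = - (\<Sum>t\<noteq>s. h(t) L(s-t))\<close>. Hence \<open>|L| \<le> n/(2T)\<close> off \<open>0\<close>
  forces \<open>(2T+1) |h(s)| \<le> \<parallel>h\<parallel>\<^sub>1\<close>, and no set of \<open>T\<close> points carries half of the
  \<open>\<ell>\<^sub>1\<close> norm of \<open>h\<close>.\<close>

section \<open>Exponential moments of the cosine of a uniform angle\<close>

text \<open>The Maclaurin remainder is \<open>exp t * y ^ 5 / 120\<close> with
  \<open>exp t \<le> 3\<close>, so the terms past the cubic one are at most
  \<open>(1 / 24 + 1 / 40) * y ^ 4\<close>. The rounder constant 1/12 fits the fourth moment 3/8 of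
  the cosine: their product 1/32 is the coefficient of \<open>l ^ 4\<close> in
  \<open>exp (l^2 / 4)\<close>.\<close>

lemma exp_le_quartic:
  fixes y :: real
  assumes "\<bar>y\<bar> \<le> 1"
  shows "exp y \<le> 1 + y + y\<^sup>2 / 2 + y ^ 3 / 6 + y ^ 4 / 12"
proof -
  obtain t where t: "\<bar>t\<bar> \<le> \<bar>y\<bar>"
    and eq: "exp y = (\<Sum>m<5. y ^ m / fact m) + exp t / fact 5 * y ^ 5"
    using Maclaurin_exp_le[of y 5] by blast
  have "exp t \<le> 3"
    using t assms exp_le order_trans[of "exp t" "exp 1" 3] by simp
  moreover have "y ^ 5 \<le> y ^ 4"
    using mult_left_mono[of y 1 "y ^ 4"] assms by (simp flip: power_Suc2)
  ultimately have "exp t * y ^ 5 \<le> 3 * y ^ 4"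
    by (meson exp_ge_zero mult_left_mono mult_right_mono order_trans zero_le_even_power even_numeral)
  moreover have "y ^ 4 \<ge> 0" by simp
  ultimately show ?thesis
    unfolding eq by (simp add: numeral_eq_Suc mult_ac)
qed

text \<open>The sum is the real part of a complete sum of a nontrivial character, rotated by the
  phase \<open>\<phi>\<close>. The frequency is first reduced mod \<open>N\<close>, because
  \<open>character_sum\<close> speaks of residues.\<close>

lemma sum_cos_eq_0:
  assumes "\<not> N dvd k"
  shows "(\<Sum>u<N. cos (2 * pi * real k * real u / real N - \<phi>)) = 0"
proof (cases "N = 0")
  case False
  define s where "s = k mod N"
  have s: "s < N" "s \<noteq> 0" using assms False by (auto simp: s_def dvd_eq_mod_eq_0)
  have per: "cos (2 * pi * real k * real u / real N - \<phi>)
      = cos (2 * pi * real s * real u / real N - \<phi>)" for u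
  proof -
    have "real k = real s + real N * real (k div N)"
      unfolding s_def by (metis mod_mult_div_eq of_nat_add of_nat_mult)
    then have "2 * pi * real k * real u / real N - \<phi>
      = (2 * pi * real s * real u / real N - \<phi>) + 2 * real (k div N * u) * pi"
      using False by (simp add: field_simps)
    then show ?thesis
      by (simp only: cos_add[of "_ - _"] cos_2npi sin_2npi)
  qed
  have "(\<Sum>u<N. cis (2 * pi * real s * real u / real N)) = 0"
    using character_sum[of s N 0] s by (simp add: cis_conv_exp mult_ac)
  then have "(\<Sum>u<N. cis (2 * pi * real s * real u / real N)) * cis (- \<phi>) = 0" by simp
  then have "Re (\<Sum>u<N. cis (2 * pi * real s * real u / real N - \<phi>)) = 0"
    by (simp add: sum_distrib_right cis_mult)
  then show ?thesis by (simp add: per)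
qed simp

text \<open>Once powers are written in multiple angles, averaging over the residues kills every
  cosine; the constants that remain are the moments 1/2, 0 and 3/8.\<close>

lemma cos_power_multiple_angles:
  fixes \<phi> :: real
  shows "cos \<phi> ^ 2 = 1 / 2 + cos (2 * \<phi>) / 2"
    and "cos \<phi> ^ 3 = 3 / 4 * cos \<phi> + cos (3 * \<phi>) / 4"
    and "cos \<phi> ^ 4 = 3 / 8 + cos (2 * \<phi>) / 2 + cos (4 * \<phi>) / 8"
proof -
  show "cos \<phi> ^ 2 = 1 / 2 + cos (2 * \<phi>) / 2"
    by (simp add: cos_double_cos diff_divide_distrib)
  show "cos \<phi> ^ 3 = 3 / 4 * cos \<phi> + cos (3 * \<phi>) / 4"
    by (simp add: cos_treble_cos diff_divide_distrib)
  have "cos (4 * \<phi>) = 2 * cos (2 * \<phi>) ^ 2 - 1"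
    using cos_double_cos[of "2 * \<phi>"] by simp
  then show "cos \<phi> ^ 4 = 3 / 8 + cos (2 * \<phi>) / 2 + cos (4 * \<phi>) / 8"
    by (simp add: cos_double_cos power2_diff power_mult_distrib diff_divide_distrib
        add_divide_distrib flip: power_mult)
qed

text \<open>Averaging the quartic majorant of the exponential gives exactly
  \<open>1 + s + s^2 / 2\<close> with \<open>s = l^2 / 4\<close>, a lower Taylor bound for
  \<open>exp s\<close>. The angles occurring are multiples up to the fourth, whence the four
  non-divisibility conditions; \<open>l \<le> 1\<close> keeps the argument within the range of the
  majorant.\<close>

lemma sum_exp_cos_le:
  assumes t: "\<And>m. m \<in> {1..4} \<Longrightarrow> \<not> N dvd m * t" and l: "0 \<le> l" "l \<le> 1"
  shows "(\<Sum>u<N. exp (l * cos (2 * pi * real t * real u / real N - \<theta>)))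
    \<le> real N * exp (l\<^sup>2 / 4)"
proof -
  define \<phi> where "\<phi> = (\<lambda>u::nat. 2 * pi * real t * real u / real N - \<theta>)"
  have s: "(\<Sum>u<N. cos (real m * \<phi> u)) = 0" if "m \<in> {1..4}" for m
    using sum_cos_eq_0[OF t[OF that], of "real m * \<theta>"]
    by (simp add: \<phi>_def algebra_simps)
  have z: "(\<Sum>u<N. cos (\<phi> u)) = 0" "(\<Sum>u<N. cos (2 * \<phi> u)) = 0"
     "(\<Sum>u<N. cos (3 * \<phi> u)) = 0" "(\<Sum>u<N. cos (4 * \<phi> u)) = 0"
    using s[of 1] s[of 2] s[of 3] s[of 4] by simp_all
  have m: "(\<Sum>u<N. cos (\<phi> u) ^ 2) = real N / 2" "(\<Sum>u<N. cos (\<phi> u) ^ 3) = 0"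
     "(\<Sum>u<N. cos (\<phi> u) ^ 4) = 3 / 8 * real N"
    unfolding cos_power_multiple_angles sum.distrib
    by (simp_all add: z flip: sum_divide_distrib sum_distrib_left)
  have "(\<Sum>u<N. exp (l * cos (\<phi> u))) \<le> (\<Sum>u<N. 1 + l * cos (\<phi> u)
      + l\<^sup>2 / 2 * cos (\<phi> u) ^ 2 + l ^ 3 / 6 * cos (\<phi> u) ^ 3 + l ^ 4 / 12 * cos (\<phi> u) ^ 4)"
  proof (rule sum_mono)
    fix u
    have "\<bar>l * cos (\<phi> u)\<bar> \<le> 1" using l by (simp add: abs_mult mult_le_one)
    from exp_le_quartic[OF this] show "exp (l * cos (\<phi> u)) \<le> 1 + l * cos (\<phi> u)
      + l\<^sup>2 / 2 * cos (\<phi> u) ^ 2 + l ^ 3 / 6 * cos (\<phi> u) ^ 3 + l ^ 4 / 12 * cos (\<phi> u) ^ 4"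
      by (simp add: power_mult_distrib)
  qed
  also have "\<dots> = real N * (1 + l\<^sup>2 / 4 + (l\<^sup>2 / 4)\<^sup>2 / 2)"
    unfolding sum.distrib sum_distrib_left[symmetric] z m by (simp add: power_divide algebra_simps)
  also have "\<dots> \<le> real N * exp (l\<^sup>2 / 4)"
    using exp_lower_Taylor_quadratic[of "l\<^sup>2 / 4"] by (intro mult_left_mono) auto
  finally show ?thesis by (simp add: \<phi>_def)
qed

section \<open>Geometry of the values of the exponential sum\<close>

text \<open>Rounding \<open>Arg z\<close> to the nearest multiple of \<open>2 * pi / \<nu>\<close>
  leaves an angle \<open>\<psi>\<close> of size at most \<open>pi / \<nu>\<close>, and the component
  of \<open>z\<close> in the rounded direction is \<open>cmod z * cos \<psi>\<close>.\<close>

lemma exists_direction: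
  assumes "\<nu> > 0"
  shows "\<exists>k<\<nu>. cmod z * cos (pi / real \<nu>) \<le> Re (z * cis (- (2 * pi * real k / real \<nu>)))"
proof -
  define m where "m = round (Arg z * real \<nu> / (2 * pi))"
  define \<psi> where "\<psi> = Arg z - 2 * pi * of_int m / real \<nu>"
  \<comment> \<open>The rounded index \<open>m\<close> can be negative; reducing it mod
    \<open>\<nu>\<close> changes the angle by whole turns only.\<close>
  define k where "k = nat (m mod int \<nu>)"
  have "\<bar>of_int m - Arg z * real \<nu> / (2 * pi)\<bar> \<le> 1 / 2"
    unfolding m_def by (rule of_int_round_abs_le)
  moreover have "\<psi> = - (2 * pi / real \<nu>) * (of_int m - Arg z * real \<nu> / (2 * pi))"
    using assms by (simp add: \<psi>_def field_simps)
  ultimately have "\<bar>\<psi>\<bar> \<le> pi / real \<nu>"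
    using assms mult_left_mono[of "\<bar>of_int m - Arg z * real \<nu> / (2 * pi)\<bar>" "1/2" "2 * pi / real \<nu>"]
    by (simp add: abs_mult)
  moreover have "pi / real \<nu> \<le> pi" using assms by (simp add: field_simps)
  ultimately have "cos (pi / real \<nu>) \<le> cos \<bar>\<psi>\<bar>"
    by (intro cos_monotone_0_pi_le) auto
  then have c: "cos (pi / real \<nu>) \<le> cos \<psi>" by simp
  have k: "int k = m - int \<nu> * (m div int \<nu>)"
    using assms by (simp add: k_def minus_mult_div_eq_mod)
  then have "real k = of_int m - real \<nu> * of_int (m div int \<nu>)"
    by (metis of_int_diff of_int_mult of_int_of_nat_eq)
  then have "Arg z - 2 * pi * real k / real \<nu> = \<psi> + 2 * pi * of_int (m div int \<nu>)"
    using assms by (simp add: \<psi>_def diff_divide_distrib right_diff_distrib)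
  then have "cos (Arg z - 2 * pi * real k / real \<nu>) = cos \<psi>"
    by (simp add: cos_add)
  moreover have "z * cis (- (2 * pi * real k / real \<nu>))
      = of_real (cmod z) * cis (Arg z - 2 * pi * real k / real \<nu>)"
    by (subst (1) rcis_cmod_Arg[of z, symmetric]) (simp add: rcis_def cis_mult)
  ultimately have "Re (z * cis (- (2 * pi * real k / real \<nu>))) = cmod z * cos \<psi>"
    by simp
  moreover have "k < \<nu>" using assms by (simp add: k_def nat_less_iff)
  ultimately show ?thesis using c by (auto intro!: exI[of _ k] mult_left_mono)
qed

text \<open>The sums at \<open>t\<close> and \<open>N - t\<close> are complex conjugates. Only half
  of the nonzero times then enter the union bound, which is the source of the factor 1/2 in the
  estimate.\<close>

lemma cmod_exp_sum_reflect:
  assumes "t \<le> N" "N > 0"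
  shows "cmod (exp_sum N n X (N - t)) = cmod (exp_sum N n X t)"
proof -
  have "exp (2 * complex_of_real pi * \<i> * of_nat (N - t) * of_nat v / of_nat N)
     = cnj (exp (2 * complex_of_real pi * \<i> * of_nat t * of_nat v / of_nat N))" for v
  proof -
    have "exp (2 * complex_of_real pi * \<i> * of_nat (N - t) * of_nat v / of_nat N)
      = exp (- (2 * complex_of_real pi * \<i> * of_nat t * of_nat v / of_nat N))
        * exp (2 * of_int (int v) * of_real pi * \<i>)"
      using assms unfolding exp_add[symmetric]
      by (intro arg_cong[of _ _ exp]) (simp add: field_simps of_nat_diff)
    also have "exp (2 * of_int (int v) * of_real pi * \<i>) = 1"
      unfolding exp_eq_1 by (auto intro!: exI[of _ "int v"])
    finally show ?thesis by (simp add: exp_cnj)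
  qed
  then have "exp_sum N n X (N - t) = cnj (exp_sum N n X t)"
    by (simp add: exp_sum_def)
  then show ?thesis by simp
qed

lemma exp_sum_cis:
  "exp_sum N n X t = (\<Sum>j=1..n. cis (2 * pi * real t * real (X j) / real N))"
  by (simp add: exp_sum_def cis_conv_exp mult_ac)

lemma exp_sum_0: "exp_sum N n X 0 = of_nat n"
  by (simp add: exp_sum_def)

section \<open>Probability bounds for the exponential sum\<close>

context uniform_sample
begin

lemma sample_measurable [measurable]:
  "j \<in> {1..n} \<Longrightarrow> X j \<in> measurable M (count_space {..<N})"
  using indep by (auto simp: indep_vars_def)

lemma sample_less: "j \<in> {1..n} \<Longrightarrow> w \<in> space M \<Longrightarrow> X j w < N"
  using measurable_space[OF sample_measurable] by auto

lemma expectation_sample: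
  fixes f :: "nat \<Rightarrow> real"
  assumes "j \<in> {1..n}"
  shows "expectation (\<lambda>w. f (X j w)) = (\<Sum>u<N. f u) / real N"
proof -
  have "expectation (\<lambda>w. f (X j w)) = integral\<^sup>L (distr M (count_space {..<N}) (X j)) f"
    by (subst integral_distr[OF sample_measurable[OF assms]]) auto
  then show ?thesis
    by (simp add: uniform[OF assms] integral_uniform_count_measure)
qed

text \<open>A condition that looks only at the finitely many sampled values defines a finite union
  of sets on which the whole sample is constant, so it is measurable whatever its logical
  form.\<close>

lemma sample_event:
  assumes cong: "\<And>f g. (\<And>j. j \<in> {1..n} \<Longrightarrow> f j = g j) \<Longrightarrow> P f \<longleftrightarrow> P g"
  shows "{w \<in> space M. P (\<lambda>j. X j w)} \<in> events"
proof -
  let ?F = "{f \<in> {1..n} \<rightarrow>\<^sub>E {..<N}. P f}"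
  have "{w \<in> space M. P (\<lambda>j. X j w)} = (\<Union>f\<in>?F. {w \<in> space M. \<forall>j\<in>{1..n}. X j w = f j})"
  proof (intro equalityI subsetI)
    fix w assume w: "w \<in> {w \<in> space M. P (\<lambda>j. X j w)}"
    let ?f = "\<lambda>j\<in>{1..n}. X j w"
    have "?f \<in> {1..n} \<rightarrow>\<^sub>E {..<N}" using w sample_less by auto
    moreover have "P ?f" using w cong[of ?f "\<lambda>j. X j w"] by auto
    ultimately show "w \<in> (\<Union>f\<in>?F. {w \<in> space M. \<forall>j\<in>{1..n}. X j w = f j})"
      using w by (intro UN_I[of ?f]) auto
  next
    fix w assume "w \<in> (\<Union>f\<in>?F. {w \<in> space M. \<forall>j\<in>{1..n}. X j w = f j})"
    then obtain f where f: "P f" "w \<in> space M" "\<forall>j\<in>{1..n}. X j w = f j" by auto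
    then show "w \<in> {w \<in> space M. P (\<lambda>j. X j w)}"
      using cong[of f "\<lambda>j. X j w"] by auto
  qed
  moreover have "finite ?F"
    by (rule finite_subset[of _ "{1..n} \<rightarrow>\<^sub>E {..<N}"]) (auto intro: finite_PiE)
  moreover have "{w \<in> space M. \<forall>j\<in>{1..n}. X j w = f j} \<in> events" for f
  proof (intro sets.sets_Collect_finite_All)
    fix j assume "j \<in> {1..n}"
    then have "X j -` ({f j} \<inter> {..<N}) \<inter> space M \<in> events"
      by (intro measurable_sets[OF sample_measurable]) auto
    moreover have "X j -` ({f j} \<inter> {..<N}) \<inter> space M = {w \<in> space M. X j w = f j}"
      using sample_less \<open>j \<in> {1..n}\<close> by auto
    ultimately show "{w \<in> space M. X j w = f j} \<in> events" by simp
  qed simp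
  ultimately show ?thesis by (auto intro!: sets.finite_UN)
qed

lemma prob_directional_sum_ge:
  assumes t: "\<And>m. m \<in> {1..4} \<Longrightarrow> \<not> N dvd m * t" and l: "0 < l" "l \<le> 1"
  shows "prob {w \<in> space M. r \<le> (\<Sum>j=1..n. cos (2 * pi * real t * real (X j w) / real N - \<theta>))}
    \<le> exp (real n * l\<^sup>2 / 4 - l * r)"
proof -
  define Y where "Y = (\<lambda>j w. cos (2 * pi * real t * real (X j w) / real N - \<theta>))"
  define S where "S = (\<lambda>w. \<Sum>j=1..n. Y j w)"
  have ind: "indep_vars (\<lambda>_. borel) (\<lambda>j w. exp (l * Y j w)) {1..n}"
    unfolding Y_def
    by (rule indep_vars_compose2[OF indep, of "\<lambda>_ u. exp (l * cos (2 * pi * real t * real u / real N - \<theta>))"])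
       simp
  have Yb: "random_variable borel (Y j)" if "j \<in> {1..n}" for j
    unfolding Y_def
    using measurable_compose[OF sample_measurable[OF that], of
        "\<lambda>u. cos (2 * pi * real t * real u / real N - \<theta>)" borel] by simp
  then have Sm: "random_variable borel S" unfolding S_def by (intro borel_measurable_sum) auto
  have int1: "integrable M (\<lambda>w. exp (l * Y j w))" if "j \<in> {1..n}" for j
    using Yb[OF that] l
    by (intro integrable_const_bound[of _ "exp l"] AE_I2) (auto simp: Y_def)
  have expS: "exp (l * S w) = (\<Prod>j=1..n. exp (l * Y j w))" for w
    by (simp add: S_def sum_distrib_left exp_sum)
  have "expectation (\<lambda>w. exp (l * S w)) = (\<Prod>j=1..n. expectation (\<lambda>w. exp (l * Y j w)))"
    unfolding expS by (rule indep_vars_lebesgue_integral[OF _ ind int1]) simp_all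
  also have "\<dots> \<le> (\<Prod>j=1..n. exp (l\<^sup>2 / 4))"
  proof (intro prod_mono conjI)
    fix j assume j: "j \<in> {1..n}"
    \<comment> \<open>For \<open>N = 0\<close> the average is a division by zero, hence 0, and the
      bound is trivial.\<close>
    show "expectation (\<lambda>w. exp (l * Y j w)) \<le> exp (l\<^sup>2 / 4)"
      using expectation_sample[OF j, of "\<lambda>u. exp (l * cos (2 * pi * real t * real u / real N - \<theta>))"]
        sum_exp_cos_le[OF t, of l \<theta>] l
      by (cases "N = 0") (simp_all add: Y_def divide_le_eq mult.commute)
  qed simp
  also have "\<dots> = exp (real n * l\<^sup>2 / 4)"
    by (simp add: exp_of_nat_mult[symmetric])
  finally have E: "expectation (\<lambda>w. exp (l * S w)) \<le> exp (real n * l\<^sup>2 / 4)" .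
  have "integrable M (\<lambda>w. exp (l * S w))"
    unfolding expS by (rule indep_vars_integrable[OF _ ind int1]) simp_all
  then have "prob {w \<in> space M. r \<le> S w} \<le> exp (- l * r) * expectation (\<lambda>w. exp (l * S w))"
    using Chernoff_ineq_ge[of l "space M" S r] l
    by (simp add: set_integrable_def set_lebesgue_integral_def mult.commute[of "indicator _ _"]
          cong: Bochner_Integration.integral_cong Bochner_Integration.integrable_cong)
  also have "\<dots> \<le> exp (- l * r) * exp (real n * l\<^sup>2 / 4)"
    using E by (intro mult_left_mono) auto
  finally show ?thesis by (simp add: S_def Y_def exp_add[symmetric])
qed

lemma prob_exp_sum_ge:
  assumes N: "prime N" "N \<ge> 5" and t: "0 < t" "t < N" and T: "T \<ge> 1" and \<nu>: "\<nu> \<ge> 3"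
    and n: "real n = 4 * C * (real T)\<^sup>2 * ln (real N)"
  shows "prob {w \<in> space M. real n / (2 * real T) \<le> cmod (exp_sum N n (\<lambda>j. X j w) t)}
     \<le> real \<nu> * real N powr (- C * (cos (pi / real \<nu>))\<^sup>2)"
proof -
  define a where "a = cos (pi / real \<nu>)"
  define r where "r = real n / (2 * real T)"
  define D where "D = (\<lambda>k::nat. {w \<in> space M.
    r * a \<le> (\<Sum>j=1..n. cos (2 * pi * real t * real (X j w) / real N - 2 * pi * real k / real \<nu>))})"
  \<comment> \<open>Positivity comes from \<open>\<nu> \<ge> 3\<close>, which puts
    \<open>pi / \<nu>\<close> below \<open>pi / 2\<close>.\<close>
  have a: "0 < a" "a \<le> 1"
    using \<nu> by (auto simp: a_def field_simps intro!: cos_gt_zero)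
  have ndvd: "\<not> N dvd m * t" if "m \<in> {1..4}" for m
    using that N t by (auto simp: prime_dvd_mult_iff dest!: dvd_imp_le)
  have Dm: "D k \<in> events" for k
    unfolding D_def by (rule sample_event) simp
  have Dp: "prob (D k) \<le> real N powr (- C * a\<^sup>2)" for k
  proof -
    \<comment> \<open>The exponent \<open>n * l^2 / 4 - l * r * a\<close> is minimal at
      \<open>l = 2 * r * a / n = a / T\<close>, which lies in the admissible range since
      \<open>a \<le> 1 \<le> T\<close>.\<close>
    have "prob (D k) \<le> exp (real n * (a / real T)\<^sup>2 / 4 - a / real T * (r * a))"
      unfolding D_def using a T by (intro prob_directional_sum_ge ndvd) (auto simp: field_simps)
    also have "real n * (a / real T)\<^sup>2 / 4 - a / real T * (r * a) = - C * a\<^sup>2 * ln (real N)"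
      using T by (simp add: r_def n field_simps power2_eq_square)
    finally show ?thesis using N by (simp add: powr_def)
  qed
  have "prob {w \<in> space M. r \<le> cmod (exp_sum N n (\<lambda>j. X j w) t)} \<le> prob (\<Union>k<\<nu>. D k)"
  proof (intro finite_measure_mono subsetI)
    fix w assume w: "w \<in> {w \<in> space M. r \<le> cmod (exp_sum N n (\<lambda>j. X j w) t)}"
    obtain k where k: "k < \<nu>" and le: "cmod (exp_sum N n (\<lambda>j. X j w) t) * a
        \<le> Re (exp_sum N n (\<lambda>j. X j w) t * cis (- (2 * pi * real k / real \<nu>)))"
      using exists_direction[of \<nu> "exp_sum N n (\<lambda>j. X j w) t"] \<nu> by (auto simp: a_def)
    have "r * a \<le> cmod (exp_sum N n (\<lambda>j. X j w) t) * a"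
      using w a by (intro mult_right_mono) auto
    with le have "w \<in> D k"
      using w by (simp add: D_def exp_sum_cis sum_distrib_right cis_mult)
    with k show "w \<in> (\<Union>k<\<nu>. D k)" by auto
  qed (use Dm in auto)
  also have "\<dots> \<le> (\<Sum>k<\<nu>. prob (D k))"
    using Dm by (intro finite_measure_subadditive_finite) auto
  also have "\<dots> \<le> real \<nu> * real N powr (- C * a\<^sup>2)"
    using sum_bounded_above[of "{..<\<nu>}" "\<lambda>k. prob (D k)", OF Dp] by simp
  finally show ?thesis by (simp add: r_def a_def)
qed

lemma small_sum_prob_gt:
  assumes N: "prime N" "N \<ge> 5" and T: "T \<ge> 1" and \<nu>: "\<nu> \<ge> 3"
    and n: "real n = 4 * C * (real T)\<^sup>2 * ln (real N)"
  shows "small_sum_prob M T N n X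
    > 1 - real \<nu> / 2 * real N powr (1 - C * (cos (pi / real \<nu>))\<^sup>2)"
proof -
  define p where "p = real N powr (- C * (cos (pi / real \<nu>))\<^sup>2)"
  define B where "B = (\<lambda>t. {w \<in> space M.
    real n / (2 * real T) \<le> cmod (exp_sum N n (\<lambda>j. X j w) t)})"
  define A where "A = {w \<in> space M. (SUP t\<in>{..<N} - {0}. cmod (exp_sum N n (\<lambda>j. X j w) t))
       < 1 / (2 * real T) * Re (exp_sum N n (\<lambda>j. X j w) 0)}"
  have exp_cong: "exp_sum N n f = exp_sum N n g" if "\<And>j. j \<in> {1..n} \<Longrightarrow> f j = g j" for f g
    using that unfolding exp_sum_def by (intro ext sum.cong) auto
  have Bm: "B t \<in> events" for t
    unfolding B_def by (rule sample_event) (subst exp_cong, auto)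
  have Am: "A \<in> events"
    unfolding A_def by (rule sample_event) (subst (1 2) exp_cong, auto)
  \<comment> \<open>Oddness splits the nonzero residues into pairs \<open>t\<close>,
    \<open>N - t\<close>, each with a member in \<open>{1..N div 2}\<close>.\<close>
  have "odd N" using N prime_odd_nat by auto
  then have half: "N - t \<le> N div 2" if "t > N div 2" for t
    using that by presburger
  have sub: "space M - A \<subseteq> (\<Union>t\<in>{1..N div 2}. B t)"
  proof
    fix w assume w: "w \<in> space M - A"
    let ?c = "\<lambda>t. cmod (exp_sum N n (\<lambda>j. X j w) t)"
    have "1 \<in> {..<N} - {0}" using N by simp
    then have "finite ({..<N} - {0})" "{..<N} - {0} \<noteq> {}" by (simp, blast)
    \<comment> \<open>The supremum over a finite nonempty set is attained, so its failure to be
      small is witnessed by a single time.\<close>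
    then have "(SUP t\<in>{..<N} - {0}. ?c t) \<in> ?c ` ({..<N} - {0})"
      by (subst cSup_eq_Max) (auto intro!: Max_in)
    then obtain t where t: "t < N" "t \<noteq> 0" and "real n / (2 * real T) \<le> ?c t"
      using w by (force simp: A_def exp_sum_0 not_less)
    moreover from this have "real n / (2 * real T) \<le> ?c (N - t)"
      by (subst cmod_exp_sum_reflect) auto
    ultimately have "w \<in> B t" "w \<in> B (N - t)" using w by (auto simp: B_def)
    then show "w \<in> (\<Union>t\<in>{1..N div 2}. B t)"
      using half[of t] t by (cases "t \<le> N div 2") auto
  qed
  have "1 - prob A = prob (space M - A)" using Am by (simp add: prob_compl)
  also have "\<dots> \<le> prob (\<Union>t\<in>{1..N div 2}. B t)"
    using sub Bm by (intro finite_measure_mono) auto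
  also have "\<dots> \<le> (\<Sum>t=1..N div 2. prob (B t))"
    using Bm by (intro finite_measure_subadditive_finite) auto
  also have "\<dots> \<le> real (card {1..N div 2}) * (real \<nu> * p)"
  proof (rule sum_bounded_above)
    fix t assume "t \<in> {1..N div 2}"
    then show "prob (B t) \<le> real \<nu> * p"
      unfolding B_def p_def using N by (intro prob_exp_sum_ge[OF N _ _ T \<nu> n]) auto
  qed
  also have "\<dots> < real N / 2 * (real \<nu> * p)"
  \<comment> \<open>The strict inequality of the conclusion arises here: for odd \<open>N\<close>
    there are only \<open>(N - 1) / 2\<close> pairs.\<close>
  proof (rule mult_strict_right_mono)
    have "2 * (N div 2) < N" using \<open>odd N\<close> by presburger
    then show "real (card {1..N div 2}) < real N / 2" by simp
  qed (use N \<nu> in \<open>simp add: p_def\<close>)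
  also have "\<dots> = real \<nu> / 2 * real N powr (1 - C * (cos (pi / real \<nu>))\<^sup>2)"
    using N powr_add[of "real N" 1 "- C * (cos (pi / real \<nu>))\<^sup>2"] by (simp add: p_def)
  finally show ?thesis by (simp add: small_sum_prob_def A_def)
qed

end

section \<open>Recovery from small exponential sums\<close>

text \<open>A competitor is \<open>y = x + h\<close>, where the transform of \<open>h\<close>
  vanishes on the sampled frequencies. As \<open>h\<close> has less than half of its
  \<open>l1_norm\<close> on the support of \<open>x\<close>, what it adds off the support outweighs
  what it can cancel on it.\<close>

lemma property_alpha_if_small_exp_sum:
  assumes n: "n > 0" and X: "\<And>j. j \<in> {1..n} \<Longrightarrow> X j < N"
    and small: "\<And>t. 0 < t \<Longrightarrow> t < N \<Longrightarrow> 2 * real T * cmod (exp_sum N n X t) \<le> real n"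
    and x: "x \<in> signals N" "l0_norm N x \<le> T"
  shows "property_alpha N (X ` {1..n}) x"
  unfolding property_alpha_iff[OF x(1)]
proof (intro ballI impI)
  fix y assume y: "y \<in> signals N" "y \<noteq> x"
    and eq: "\<forall>\<omega>\<in>X ` {1..n}. fourier N y \<omega> = fourier N x \<omega>"
  define h where "h = (\<lambda>t. y t - x t)"
  define H where "H = (\<Sum>t<N. cmod (h t))"
  define S where "S = {t \<in> {..<N}. x t \<noteq> 0}"
  \<comment> \<open>\<open>K s t\<close> is the exponential sum at the difference of
    \<open>s\<close> and \<open>t\<close>, written with real differences so that negative ones make
    sense.\<close>
  define K where "K = (\<lambda>s t. \<Sum>j=1..n. cis (2 * pi * (real s - real t) * real (X j) / real N))"
  have K_same: "K s s = of_nat n" for s by (simp add: K_def)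
  have K_small: "2 * real T * cmod (K s t) \<le> real n" if "s < N" "t < N" "s \<noteq> t" for s t
  proof (cases "t \<le> s")
    case True
    then have "K s t = exp_sum N n X (s - t)" by (simp add: K_def exp_sum_cis of_nat_diff)
    then show ?thesis using small[of "s - t"] that True by simp
  next
    case False
    then have "K s t = cnj (exp_sum N n X (t - s))"
      by (simp add: K_def exp_sum_cis of_nat_diff cis_cnj minus_divide_left left_diff_distrib
          right_diff_distrib)
    then show ?thesis using small[of "t - s"] that False by simp
  qed
  have zero: "(\<Sum>t<N. h t * cis (- (2 * pi * real t * real (X j) / real N))) = 0"
    if "j \<in> {1..n}" for j
  proof -
    have "N > 0" using X[OF that] by simp
    moreover have "fourier N y (X j) - fourier N x (X j) = 0" using eq that by simp
    ultimately have "(\<Sum>t<N. h t * exp (- 2 * complex_of_real pi * \<i> * of_nat t * of_nat (X j) / of_nat N)) = 0"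
      using X[OF that] by (simp add: fourier_def h_def left_diff_distrib sum_subtractf
          flip: right_diff_distrib)
    then show ?thesis by (simp add: cis_conv_exp mult_ac)
  qed
  have point: "(2 * real T + 1) * cmod (h s) \<le> H" if s: "s < N" for s
  proof -
    \<comment> \<open>Interchanging the sums exposes, for each \<open>j\<close>, the transform of
      \<open>h\<close> at \<open>X j\<close> up to a factor; it is zero.\<close>
    have "(\<Sum>t<N. h t * K s t) = (\<Sum>j=1..n. cis (2 * pi * real s * real (X j) / real N)
        * (\<Sum>t<N. h t * cis (- (2 * pi * real t * real (X j) / real N))))"
      unfolding K_def sum_distrib_left
      by (subst sum.swap, intro sum.cong refl)
         (simp add: cis_mult mult.left_commute[of "cis _"] diff_divide_distrib left_diff_distrib right_diff_distrib)
    also have "\<dots> = 0" by (simp add: zero)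
    finally have "h s * K s s = - (\<Sum>t\<in>{..<N} - {s}. h t * K s t)"
      using s by (simp add: sum.remove[of "{..<N}" s] eq_neg_iff_add_eq_0)
    then have "cmod (h s) * real n = cmod (\<Sum>t\<in>{..<N} - {s}. h t * K s t)"
      by (metis K_same norm_minus_cancel norm_mult norm_of_nat)
    also have "\<dots> \<le> (\<Sum>t\<in>{..<N} - {s}. cmod (h t) * cmod (K s t))"
      by (rule order_trans[OF norm_sum]) (simp add: norm_mult)
    finally have "2 * real T * (cmod (h s) * real n)
      \<le> 2 * real T * (\<Sum>t\<in>{..<N} - {s}. cmod (h t) * cmod (K s t))"
      by (rule mult_left_mono) simp
    also have "\<dots> = (\<Sum>t\<in>{..<N} - {s}. cmod (h t) * (2 * real T * cmod (K s t)))"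
      by (simp add: sum_distrib_left mult_ac)
    also have "\<dots> \<le> (\<Sum>t\<in>{..<N} - {s}. cmod (h t) * real n)"
      using K_small[OF s] by (intro sum_mono mult_left_mono) auto
    also have "\<dots> = (H - cmod (h s)) * real n"
      using s by (simp add: H_def sum.remove[of "{..<N}" s] sum_distrib_right)
    finally have "((2 * real T + 1) * cmod (h s)) * real n \<le> H * real n"
      by (simp add: algebra_simps)
    then show ?thesis using n by simp
  qed
  have "(2 * real T + 1) * (\<Sum>t\<in>S. cmod (h t)) \<le> real (card S) * H"
    unfolding sum_distrib_left using point by (intro sum_bounded_above) (auto simp: S_def)
  moreover have "H \<ge> 0" by (simp add: H_def sum_nonneg)
  moreover have "card S \<le> T" using x(2) by (simp add: S_def l0_norm_def)
  ultimately have S_le: "(2 * real T + 1) * (\<Sum>t\<in>S. cmod (h t)) \<le> real T * H"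
    by (meson mult_right_mono of_nat_le_iff order_trans)
  \<comment> \<open>Signals are extensional, so distinct ones differ at some residue. Then
    \<open>H > 0\<close> and the share \<open>T / (2 * T + 1)\<close> gives a strict
    inequality.\<close>
  have "\<exists>t<N. h t \<noteq> 0"
    using y x(1) PiE_ext[of y "{..<N}" "\<lambda>_. UNIV" x] by (auto simp: h_def signals_def)
  then have "H > 0" unfolding H_def by (auto intro!: sum_pos2)
  then have "(2 * real T + 1) * (2 * (\<Sum>t\<in>S. cmod (h t))) < (2 * real T + 1) * H"
    using S_le by (simp add: algebra_simps)
  then have half: "2 * (\<Sum>t\<in>S. cmod (h t)) < H"
    by (simp add: mult_less_cancel_left_pos)
  \<comment> \<open>Pointwise comparison: off \<open>S\<close> the competitor equals
    \<open>h\<close>, while on \<open>S\<close> the triangle inequality gives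
    \<open>cmod (x t) - cmod (h t) \<le> cmod (y t)\<close>.\<close>
  have "l1_norm N x + H - 2 * (\<Sum>t\<in>S. cmod (h t))
      = (\<Sum>t<N. cmod (x t) + cmod (h t) - 2 * (if t \<in> S then cmod (h t) else 0))"
  proof -
    have "{..<N} \<inter> S = S" by (auto simp: S_def)
    then show ?thesis
      by (simp add: l1_norm_def H_def sum.distrib sum_subtractf sum.inter_restrict[symmetric]
        flip: sum_distrib_left)
  qed
  also have "\<dots> \<le> l1_norm N y" unfolding l1_norm_def
  proof (rule sum_mono)
    fix t assume "t \<in> {..<N}"
    then show "cmod (x t) + cmod (h t) - 2 * (if t \<in> S then cmod (h t) else 0) \<le> cmod (y t)"
      using norm_triangle_ineq2[of "x t" "x t - y t"] by (auto simp: h_def S_def norm_minus_commute)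
  qed
  finally show "l1_norm N x < l1_norm N y" using half by simp
qed

lemma (in uniform_sample) small_sum_prob_le_recovery_prob:
  assumes "T \<ge> 1" "n > 0"
  shows "small_sum_prob M T N n X \<le> recovery_prob M T N n X"
  unfolding small_sum_prob_def recovery_prob_def
proof (rule finite_measure_mono)
  show "{w \<in> space M. (SUP t\<in>{..<N} - {0}. cmod (exp_sum N n (\<lambda>j. X j w) t))
        < 1 / (2 * real T) * Re (exp_sum N n (\<lambda>j. X j w) 0)}
    \<subseteq> {w \<in> space M. \<forall>x\<in>signals N. l0_norm N x \<le> T \<longrightarrow>
        property_alpha N ((\<lambda>j. X j w) ` {1..n}) x}"
  proof (safe)
    fix w x
    assume w: "w \<in> space M" and x: "x \<in> signals N" "l0_norm N x \<le> T"
      and less: "(SUP t\<in>{..<N} - {0}. cmod (exp_sum N n (\<lambda>j. X j w) t))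
        < 1 / (2 * real T) * Re (exp_sum N n (\<lambda>j. X j w) 0)"
    show "property_alpha N ((\<lambda>j. X j w) ` {1..n}) x"
    proof (rule property_alpha_if_small_exp_sum[OF assms(2) _ _ x])
      fix t assume "0 < t" "t < N"
      then have "cmod (exp_sum N n (\<lambda>j. X j w) t)
          \<le> (SUP t\<in>{..<N} - {0}. cmod (exp_sum N n (\<lambda>j. X j w) t))"
        by (intro cSUP_upper bdd_above_finite) auto
      also note less
      finally show "2 * real T * cmod (exp_sum N n (\<lambda>j. X j w) t) \<le> real n"
        using assms by (simp add: exp_sum_0 field_simps)
    qed (use w sample_less in auto)
  qed
  \<comment> \<open>The recovery event quantifies over uncountably many signals, but it depends on
    the sample only through its set of values.\<close>
  have "f ` {1..n} = g ` {1..n}" if "\<And>j. j \<in> {1..n} \<Longrightarrow> f j = g j" for f g :: "nat \<Rightarrow> nat"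
    using that by auto
  then show "{w \<in> space M. \<forall>x\<in>signals N. l0_norm N x \<le> T \<longrightarrow>
        property_alpha N ((\<lambda>j. X j w) ` {1..n}) x} \<in> events"
    by (intro sample_event) metis
qed

section \<open>Asymptotics along the primes\<close>

text \<open>Since \<open>cos (pi / \<nu>)\<close> tends to 1, the loss in the exponent caused by
  finitely many directions can be made as small as desired.\<close>

lemma exists_mult_cos_square_gt:
  fixes c d :: real
  assumes "d < c"
  shows "\<exists>\<nu>\<ge>3. d < c * (cos (pi / real \<nu>))\<^sup>2"
proof -
  have "(\<lambda>\<nu>. c * (cos (pi / real \<nu>))\<^sup>2) \<longlonglongrightarrow> c * (cos 0)\<^sup>2"
    by (intro tendsto_intros lim_const_over_n)
  then have "\<forall>\<^sub>F \<nu> in sequentially. d < c * (cos (pi / real \<nu>))\<^sup>2"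
    using assms by (intro order_tendstoD) auto
  then have "\<forall>\<^sub>F \<nu> in sequentially. \<nu> \<ge> 3 \<and> d < c * (cos (pi / real \<nu>))\<^sup>2"
    using eventually_ge_at_top[of "3::nat"] by eventually_elim simp
  then show ?thesis by (auto dest: eventually_happens)
qed

text \<open>\<open>C\<close> may vary with \<open>N\<close>, so its lower limit takes the place of a
  constant. A real \<open>c\<close> strictly between \<open>\<delta> + 1\<close> and this limit,
  which may be infinite, allows one \<open>\<nu>\<close> for all \<open>N\<close>, and
  \<open>\<nu> / 2\<close> becomes the implied constant.\<close>

lemma recovery_failure_bigo:
  fixes T n :: "nat \<Rightarrow> nat" and C :: "nat \<Rightarrow> real" and F :: "nat filter"
  assumes F: "\<forall>\<^sub>F N in F. prime N \<and> N \<ge> 5"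
    and ev: "\<forall>\<^sub>F N in F. T N \<ge> 1 \<and> C N > 1 \<and>
           real (n N) = 4 * C N * (real (T N))\<^sup>2 * ln (real N) \<and>
           uniform_sample (M N) N (n N) (X N)"
    and \<delta>: "ereal \<delta> < Liminf F (\<lambda>N. ereal (C N)) - 1"
  shows "(\<lambda>N. 1 - recovery_prob (M N) (T N) N (n N) (X N)) \<in> O[F](\<lambda>N. real N powr (- \<delta>))"
proof -
  have "ereal (\<delta> + 1) < Liminf F (\<lambda>N. ereal (C N))"
    using \<delta> by (cases "Liminf F (\<lambda>N. ereal (C N))") (auto simp: one_ereal_def)
  then obtain c where c: "ereal (\<delta> + 1) < ereal c" "ereal c < Liminf F (\<lambda>N. ereal (C N))"
    using ereal_dense2 by blast
  obtain \<nu> where \<nu>: "\<nu> \<ge> 3" "\<delta> + 1 < c * (cos (pi / real \<nu>))\<^sup>2"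
    using exists_mult_cos_square_gt[of "\<delta> + 1" c] c by auto
  have "\<forall>\<^sub>F N in F. c < C N"
    using less_LiminfD[OF c(2)] by simp
  with F ev have "\<forall>\<^sub>F N in F. norm (1 - recovery_prob (M N) (T N) N (n N) (X N))
      \<le> real \<nu> / 2 * norm (real N powr (- \<delta>))"
  proof eventually_elim
    case (elim N)
    then interpret uniform_sample "M N" N "n N" "X N" by simp
    let ?a2 = "(cos (pi / real \<nu>))\<^sup>2"
    have "0 < 4 * C N * (real (T N))\<^sup>2 * ln (real N)"
      using elim by (intro mult_pos_pos) auto
    then have "n N > 0" using elim by (metis of_nat_0_less_iff)
    then have "small_sum_prob (M N) (T N) N (n N) (X N) \<le> recovery_prob (M N) (T N) N (n N) (X N)"
      using elim by (intro small_sum_prob_le_recovery_prob) auto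
    moreover have "small_sum_prob (M N) (T N) N (n N) (X N)
        > 1 - real \<nu> / 2 * real N powr (1 - C N * ?a2)"
      using elim \<nu> by (intro small_sum_prob_gt) auto
    moreover have "real \<nu> / 2 * real N powr (1 - C N * ?a2) \<le> real \<nu> / 2 * real N powr (- \<delta>)"
    proof (intro mult_left_mono powr_mono)
      have "c * ?a2 \<le> C N * ?a2" using elim by (intro mult_right_mono) auto
      then show "1 - C N * ?a2 \<le> - \<delta>" using \<nu> by simp
    qed (use elim in auto)
    moreover have "recovery_prob (M N) (T N) N (n N) (X N) \<le> 1"
      by (simp add: recovery_prob_def)
    ultimately show ?case by simp
  qed
  then show ?thesis by (rule bigoI)
qed

theorem theorem3:
  shows
    "(\<forall>(T::nat) (N::nat) (n::nat) (C::real) (M::'w measure) X.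
        T \<ge> 1 \<longrightarrow> N \<ge> 5 \<longrightarrow> prime N \<longrightarrow> C > 1 \<longrightarrow>
        real n = 4 * C * (real T)\<^sup>2 * ln (real N) \<longrightarrow>
        uniform_sample M N n X \<longrightarrow>
        (\<forall>\<nu>::nat. \<nu> \<ge> 3 \<longrightarrow>
           small_sum_prob M T N n X
             > 1 - real \<nu> / 2 * real N powr (1 - C * (cos (pi / real \<nu>))\<^sup>2)))
     \<and>
     (\<forall>(T::nat \<Rightarrow> nat) (n::nat \<Rightarrow> nat) (C::nat \<Rightarrow> real) (M::nat \<Rightarrow> 'w measure) X.
        let primes_at_top = inf sequentially (principal {N. prime N}) in
        (\<forall>\<^sub>F N in primes_at_top.
           T N \<ge> 1 \<and> C N > 1 \<and>
           real (n N) = 4 * C N * (real (T N))\<^sup>2 * ln (real N) \<and>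
           uniform_sample (M N) N (n N) (X N)) \<longrightarrow>
        (\<forall>\<delta>::real. ereal \<delta> < Liminf primes_at_top (\<lambda>N. ereal (C N)) - 1 \<longrightarrow>
           (\<lambda>N. 1 - recovery_prob (M N) (T N) N (n N) (X N))
             \<in> O[primes_at_top](\<lambda>N. real N powr (- \<delta>))))"
proof (intro conjI allI impI)
  fix T N n \<nu> :: nat and C :: real and M :: "'w measure" and X
  assume "T \<ge> 1" "N \<ge> 5" "prime N" "\<nu> \<ge> 3"
    "real n = 4 * C * (real T)\<^sup>2 * ln (real N)" "uniform_sample M N n X"
  then show "small_sum_prob M T N n X
      > 1 - real \<nu> / 2 * real N powr (1 - C * (cos (pi / real \<nu>))\<^sup>2)"
    by (intro uniform_sample.small_sum_prob_gt)
next
  \<comment> \<open>Under this filter eventual statements concern large primes only; nothing is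
    asked of the data at composite \<open>N\<close>.\<close>
  have "\<forall>\<^sub>F N in inf sequentially (principal {N. prime N}). prime N \<and> N \<ge> (5::nat)"
    using eventually_ge_at_top[of "5::nat"]
    unfolding eventually_inf_principal by (rule eventually_mono) auto
  from recovery_failure_bigo[OF this] show "let primes_at_top = inf sequentially (principal {N. prime N}) in
        (\<forall>\<^sub>F N in primes_at_top.
           T N \<ge> 1 \<and> C N > 1 \<and>
           real (n N) = 4 * C N * (real (T N))\<^sup>2 * ln (real N) \<and>
           uniform_sample (M N) N (n N) (X N)) \<longrightarrow>
        (\<forall>\<delta>::real. ereal \<delta> < Liminf primes_at_top (\<lambda>N. ereal (C N)) - 1 \<longrightarrow>
           (\<lambda>N. 1 - recovery_prob (M N) (T N) N (n N) (X N))
             \<in> O[primes_at_top](\<lambda>N. real N powr (- \<delta>)))"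
    for T n C and M :: "nat \<Rightarrow> 'w measure" and X
    unfolding Let_def by blast
qed

end
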